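(* Let $(D,G_o)$ be a two-sender unicast index-coding problem with a fully participated interaction between its sub-digraphs $D_1,D_2,D_3$. Suppose that, up to interchanging the labels $1$ and $2$ (i.e. the two senders), the arc set of $f(D)$ is one of $$\{(1,2),(2,1),(3,1)\},\quad \{(1,2),(2,1),(3,1),(3,2)\},\quad \{(1,2),(2,1),(3,1),(2,3)\},\quad \{(1,2),(2,3),(3,1)\}.$$ Then, for every $t\ge1$: (i) $\beta_t(D,G_o)\le\max\{\beta_t(D_1),\beta_t(D_3)\}+\max\{\beta_t(D_2),\beta_t(D_3)\}$; (ii) $\beta_t(D,G_o)=\beta_t(D_1)+\beta_t(D_2)$ if $\beta_t(D_3)\le\min\{\beta_t(D_1),\beta_t(D_2)\}$; (iii) $\beta(D,G_o)\le\max\{\beta(D_1),\beta(D_3)\}+\max\{\beta(D_2),\beta(D_3)\}$; (iv) $\beta(D,G_o)=\beta(D_1)+\beta(D_2)$ if $\beta(D_3)\le\min\{\beta(D_1),\beta(D_2)\}$.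
   Context: There are $N$ messages $\mathcal{M}=\{x_1,\dots,x_N\}$, $x_i\in\{0,1\}^t$, and $N$ receivers; receiver $r$ requests $x_r$ and knows $\{x_j: j\in N_D^+(r)\}$, where $D$ is a loopless digraph on $V(D)=\{1,\dots,N\}$ (the side-information digraph) and $N_D^+(r)$ is the out-neighborhood of $r$. Single sender: an index code is an encoding function of all messages into $\{0,1\}^p$ together with decoding functions by which every receiver $r$ recovers $x_r$, for all message realizations, from the codeword and its side information. $\beta_t(D)$ is the minimum of $p/t$ over index codes for $t$-bit messages, and $\beta(D)=\inf_t\beta_t(D)=\lim_{t\to\infty}\beta_t(D)$. Two senders: senders $S_1,S_2$ know $\mathcal{M}_1,\mathcal{M}_2$ with $\mathcal{M}_1\cup\mathcal{M}_2=\mathcal{M}$. A two-sender index code consists of encoding functions $\mathscr{F}_s:\{0,1\}^{|\mathcal{M}_s|t}\to\{0,1\}^{p_s}$, $s=1,2$ ($p_s\ge0$ an integer), and decoding functions by which every receiver $r$ recovers $x_r$, for all message realizations, from both sub-codewords and its side information. $\beta_t(D,G_o)$ is the minimum of $(p_1+p_2)/t$ over two-sender index codes for $t$-bit messages, and $\beta(D,G_o)=\inf_t\beta_t(D,G_o)=\lim_{t\to\infty}\beta_t(D,G_o)$. Here $G_o$ (the sender-constraint graph, with vertex set $V(D)$ and an edge $ij$ iff one of $x_i,x_j$ is in $\mathcal{M}_1\setminus\mathcal{M}_2$ and the other in $\mathcal{M}_2\setminus\mathcal{M}_1$) records the senders' message sets. Let $\mathcal{P}_1=\mathcal{M}_1\setminus\mathcal{M}_2$,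 $\mathcal{P}_2=\mathcal{M}_2\setminus\mathcal{M}_1$, $\mathcal{P}_3=\mathcal{M}_1\cap\mathcal{M}_2$. For $i\in\{1,2,3\}$, $D_i$ is the sub-digraph of $D$ induced by $\{j:x_j\in\mathcal{P}_i\}$. The digraph $f(D)$ has vertex set $\{1,2,3\}$, and $(i,j)$, $i\neq j$, is an arc of $f(D)$ iff there is an arc of $D$ from some vertex of $D_i$ to some vertex of $D_j$. The interaction is fully participated if, whenever $(i,j)$ is an arc of $f(D)$, every vertex of $D_i$ has arcs to all vertices of $D_j$. *)

theory Defs
  imports
    "HOL-Library.FuncSet"
    Complex_Main
    "Graph_Theory.Digraph_Component"
    "Graph_Theory.Pair_Digraph"
begin

definition words :: "nat \<Rightarrow> bool list set" where
  "words t = {w. length w = t}"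

definition messages :: "'a set \<Rightarrow> nat \<Rightarrow> ('a \<Rightarrow> bool list) set" where
  "messages V t = (V \<rightarrow>\<^sub>E words t)"

definition out_neighborhood :: "('a, 'b) pre_digraph \<Rightarrow> 'a \<Rightarrow> 'a set" where
  "out_neighborhood D r = {j. r \<rightarrow>\<^bsub>D\<^esub> j}"


section \<open>Single-sender index coding\<close>

definition index_code ::
  "('a, 'b) pre_digraph \<Rightarrow> nat \<Rightarrow> nat \<Rightarrow> (('a \<Rightarrow> bool list) \<Rightarrow> bool list)
    \<Rightarrow> ('a \<Rightarrow> bool list \<Rightarrow> ('a \<Rightarrow> bool list) \<Rightarrow> bool list) \<Rightarrow> bool" where
  "index_code D t p F G \<longleftrightarrow>
     F \<in> messages (verts D) t \<rightarrow> words p \<and>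
     (\<forall>x \<in> messages (verts D) t. \<forall>r \<in> verts D.
        G r (F x) (restrict x (out_neighborhood D r)) = x r)"

text \<open>The parameter \<open>t\<close> is meant to be positive. The least length exists for every finite
  digraph, since transmitting all messages uncoded is an index code.\<close>

definition beta_t :: "nat \<Rightarrow> ('a, 'b) pre_digraph \<Rightarrow> real" where
  "beta_t t D = real (LEAST p. \<exists>F G. index_code D t p F G) / real t"

definition beta :: "('a, 'b) pre_digraph \<Rightarrow> real" where
  "beta D = (INF t \<in> {1..}. beta_t t D)"


section \<open>Two-sender index coding\<close>

text \<open>The sets \<open>M1\<close> and \<open>M2\<close> contain the indices of the messages known to the two senders. They
  are the primitive data of a two-sender problem, of which the sender-constraint graph is a record;
  so they take its place as arguments below.\<close>

definition two_sender_index_code ::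
  "('a, 'b) pre_digraph \<Rightarrow> 'a set \<Rightarrow> 'a set \<Rightarrow> nat \<Rightarrow> nat \<Rightarrow> nat
    \<Rightarrow> (('a \<Rightarrow> bool list) \<Rightarrow> bool list) \<Rightarrow> (('a \<Rightarrow> bool list) \<Rightarrow> bool list)
    \<Rightarrow> ('a \<Rightarrow> bool list \<Rightarrow> bool list \<Rightarrow> ('a \<Rightarrow> bool list) \<Rightarrow> bool list) \<Rightarrow> bool" where
  "two_sender_index_code D M1 M2 t p1 p2 F1 F2 G \<longleftrightarrow>
     F1 \<in> messages M1 t \<rightarrow> words p1 \<and>
     F2 \<in> messages M2 t \<rightarrow> words p2 \<and>
     (\<forall>x \<in> messages (verts D) t. \<forall>r \<in> verts D.
        G r (F1 (restrict x M1)) (F2 (restrict x M2)) (restrict x (out_neighborhood D r)) = x r)"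

definition two_sender_beta_t :: "nat \<Rightarrow> ('a, 'b) pre_digraph \<Rightarrow> 'a set \<Rightarrow> 'a set \<Rightarrow> real" where
  "two_sender_beta_t t D M1 M2 =
     real (LEAST p. \<exists>p1 p2 F1 F2 G. p = p1 + p2 \<and> two_sender_index_code D M1 M2 t p1 p2 F1 F2 G)
       / real t"

definition two_sender_beta :: "('a, 'b) pre_digraph \<Rightarrow> 'a set \<Rightarrow> 'a set \<Rightarrow> real" where
  "two_sender_beta D M1 M2 = (INF t \<in> {1..}. two_sender_beta_t t D M1 M2)"


section \<open>Interactions between the sub-digraphs\<close>

text \<open>Part 3 consists of the common messages; indices outside 1, 2, 3 are never used.\<close>

definition message_part :: "'a set \<Rightarrow> 'a set \<Rightarrow> nat \<Rightarrow> 'a set" where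
  "message_part M1 M2 i =
     (if i = 1 then M1 - M2 else if i = 2 then M2 - M1 else if i = 3 then M1 \<inter> M2 else {})"

definition sub_digraph ::
  "('a, 'b) pre_digraph \<Rightarrow> 'a set \<Rightarrow> 'a set \<Rightarrow> nat \<Rightarrow> ('a, 'b) pre_digraph" where
  "sub_digraph D M1 M2 i = D \<restriction> message_part M1 M2 i"

definition interaction_digraph ::
  "('a, 'b) pre_digraph \<Rightarrow> 'a set \<Rightarrow> 'a set \<Rightarrow> nat pair_pre_digraph" where
  "interaction_digraph D M1 M2 =
     \<lparr> pverts = {1, 2, 3},
       parcs = {(i, j). i \<in> {1, 2, 3} \<and> j \<in> {1, 2, 3} \<and> i \<noteq> j \<and>
         (\<exists>u \<in> verts (sub_digraph D M1 M2 i). \<exists>v \<in> verts (sub_digraph D M1 M2 j). u \<rightarrow>\<^bsub>D\<^esub> v)} \<rparr>"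

definition fully_participated :: "('a, 'b) pre_digraph \<Rightarrow> 'a set \<Rightarrow> 'a set \<Rightarrow> bool" where
  "fully_participated D M1 M2 \<longleftrightarrow>
     (\<forall>(i, j) \<in> parcs (interaction_digraph D M1 M2).
        \<forall>u \<in> verts (sub_digraph D M1 M2 i). \<forall>v \<in> verts (sub_digraph D M1 M2 j). u \<rightarrow>\<^bsub>D\<^esub> v)"

definition listed_interactions :: "(nat \<times> nat) set set" where
  "listed_interactions =
     {{(1,2), (2,1), (3,1)},
      {(1,2), (2,1), (3,1), (3,2)},
      {(1,2), (2,1), (3,1), (2,3)},
      {(1,2), (2,3), (3,1)}}"

end

theory Submission
  imports Defs
begin

text \<open>Let \<open>c\<^sub>1, c\<^sub>2, c\<^sub>3\<close> be the codewords of optimal index codes for the three parts. Sender 1 transmits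
  \<open>c\<^sub>1 + c\<^sub>3\<close> and sender 2 transmits \<open>c\<^sub>2 + c\<^sub>3\<close>, sums being bitwise modulo 2 after padding with zeros.
  In each listed interaction parts 1 and 3 know part 2 and part 1, respectively, and part 2 knows
  part 1 or part 3; so every receiver can cancel a summand to get \<open>c\<^sub>3\<close>, and then the codeword of its
  own part. Conversely, in any two-sender code the sub-codeword of sender \<open>s \<in> {1, 2}\<close>, with all messages
  outside part \<open>s\<close> fixed, is an index code for part \<open>s\<close>. For the asymptotic rates,
  \<open>beta_t (k * t) D \<le> beta_t t D\<close>, so a common multiple of three nearly optimal message lengths
  is nearly optimal for all three parts at once.\<close>

section \<open>Decodability as a condition on the encoders alone\<close>

lemma restrict_eq_iff: "restrict f S = restrict g S \<longleftrightarrow> (\<forall>j \<in> S. f j = g j)"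
  by (auto simp: fun_eq_iff restrict_def)

text \<open>With \<open>h\<close> as what a receiver observes and \<open>f\<close> as what it wants,
  a decoder \<open>g\<close> exists exactly when the observation determines the wanted
  message.\<close>

lemma function_factors_iff:
  "(\<exists>g. \<forall>x \<in> M. g (h x) = f x) \<longleftrightarrow> (\<forall>x \<in> M. \<forall>y \<in> M. h x = h y \<longrightarrow> f x = f y)"
  using function_factors_left_gen[of "\<lambda>x. x \<in> M" h f] by (metis (no_types))

text \<open>Receivers decode independently, so the decoders can be eliminated one receiver at a
  time: realizations that a receiver cannot tell apart must agree on its request. The codes
  constructed below are verified through this condition and never need explicit decoders.\<close>

lemma index_code_iff:
  "(\<exists>G. index_code D t p F G) \<longleftrightarrow>
     F \<in> messages (verts D) t \<rightarrow> words p \<and>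
     (\<forall>r \<in> verts D. \<forall>x \<in> messages (verts D) t. \<forall>y \<in> messages (verts D) t.
        F x = F y \<longrightarrow> (\<forall>j \<in> out_neighborhood D r. x j = y j) \<longrightarrow> x r = y r)"
proof -
  let ?M = "messages (verts D) t"
  have "(\<exists>G. \<forall>x \<in> ?M. \<forall>r \<in> verts D. G r (F x) (restrict x (out_neighborhood D r)) = x r) \<longleftrightarrow>
    (\<forall>r \<in> verts D. \<exists>g. \<forall>x \<in> ?M. g (F x, restrict x (out_neighborhood D r)) = x r)"
    (is "?L \<longleftrightarrow> ?R")
  proof
    assume ?L
    then obtain G where "\<forall>x \<in> ?M. \<forall>r \<in> verts D. G r (F x) (restrict x (out_neighborhood D r)) = x r"
      by blast
    then show ?R by (intro ballI exI[of _ "case_prod (G _)"]) auto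
  next
    assume ?R
    then obtain G where "\<forall>r \<in> verts D. \<forall>x \<in> ?M. G r (F x, restrict x (out_neighborhood D r)) = x r"
      \<comment> \<open>Choice over the receivers assembles the separate decoders into one
        \<open>G\<close>.\<close>
      by metis
    then show ?L by (intro exI[of _ "\<lambda>r c s. G r (c, s)"]) auto
  qed
  also have "\<dots> \<longleftrightarrow> (\<forall>r \<in> verts D. \<forall>x \<in> ?M. \<forall>y \<in> ?M.
        F x = F y \<longrightarrow> (\<forall>j \<in> out_neighborhood D r. x j = y j) \<longrightarrow> x r = y r)"
    unfolding function_factors_iff by (auto simp: restrict_eq_iff)
  finally show ?thesis unfolding index_code_def by blast
qed

lemma index_codeD:
  assumes "index_code D t p F G"
  shows "x \<in> messages (verts D) t \<Longrightarrow> length (F x) = p"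
    and "r \<in> verts D \<Longrightarrow> x \<in> messages (verts D) t \<Longrightarrow> y \<in> messages (verts D) t \<Longrightarrow>
      F x = F y \<Longrightarrow> (\<And>j. j \<in> out_neighborhood D r \<Longrightarrow> x j = y j) \<Longrightarrow> x r = y r"
  using index_code_iff[THEN iffD1, OF exI, OF assms] by (auto simp: words_def)

lemma two_sender_index_code_iff:
  "(\<exists>G. two_sender_index_code D M1 M2 t p1 p2 F1 F2 G) \<longleftrightarrow>
     F1 \<in> messages M1 t \<rightarrow> words p1 \<and> F2 \<in> messages M2 t \<rightarrow> words p2 \<and>
     (\<forall>r \<in> verts D. \<forall>x \<in> messages (verts D) t. \<forall>y \<in> messages (verts D) t.
        F1 (restrict x M1) = F1 (restrict y M1) \<longrightarrow> F2 (restrict x M2) = F2 (restrict y M2) \<longrightarrow>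
        (\<forall>j \<in> out_neighborhood D r. x j = y j) \<longrightarrow> x r = y r)"
proof -
  let ?M = "messages (verts D) t"
  have "(\<exists>G. \<forall>x \<in> ?M. \<forall>r \<in> verts D. G r (F1 (restrict x M1)) (F2 (restrict x M2))
           (restrict x (out_neighborhood D r)) = x r) \<longleftrightarrow>
    (\<forall>r \<in> verts D. \<exists>g. \<forall>x \<in> ?M.
       g (F1 (restrict x M1), F2 (restrict x M2), restrict x (out_neighborhood D r)) = x r)"
    (is "?L \<longleftrightarrow> ?R")
  proof
    assume ?L
    then obtain G where "\<forall>x \<in> ?M. \<forall>r \<in> verts D. G r (F1 (restrict x M1)) (F2 (restrict x M2))
           (restrict x (out_neighborhood D r)) = x r"
      by blast
    then show ?R by (intro ballI exI[of _ "\<lambda>(c1, c2, s). G _ c1 c2 s"]) auto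
  next
    assume ?R
    then obtain G where "\<forall>r \<in> verts D. \<forall>x \<in> ?M.
       G r (F1 (restrict x M1), F2 (restrict x M2), restrict x (out_neighborhood D r)) = x r"
      by metis
    then show ?L by (intro exI[of _ "\<lambda>r c1 c2 s. G r (c1, c2, s)"]) auto
  qed
  also have "\<dots> \<longleftrightarrow> (\<forall>r \<in> verts D. \<forall>x \<in> ?M. \<forall>y \<in> ?M.
        F1 (restrict x M1) = F1 (restrict y M1) \<longrightarrow> F2 (restrict x M2) = F2 (restrict y M2) \<longrightarrow>
        (\<forall>j \<in> out_neighborhood D r. x j = y j) \<longrightarrow> x r = y r)"
    unfolding function_factors_iff by (auto simp: restrict_eq_iff)
  finally show ?thesis unfolding two_sender_index_code_def by blast
qed

text \<open>Once the decoders are eliminated, the condition is symmetric in the two senders. This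
  serves both the interchange of labels and the transfer of the lower bound from sender 1 to sender
  2.\<close>

lemma two_sender_index_code_swap:
  "(\<exists>F1 F2 G. two_sender_index_code D M1 M2 t p1 p2 F1 F2 G) \<longleftrightarrow>
   (\<exists>F1 F2 G. two_sender_index_code D M2 M1 t p2 p1 F1 F2 G)"
  unfolding two_sender_index_code_iff by blast

section \<open>Optimal single-sender codes and their rates\<close>

text \<open>The integer numerator of \<open>beta_t\<close>: codes are compared by length, and
  division by \<open>t\<close> enters only at the level of rates.\<close>

definition code_length :: "nat \<Rightarrow> ('a, 'b) pre_digraph \<Rightarrow> nat" where
  "code_length t D = (LEAST p. \<exists>F G. index_code D t p F G)"

lemma beta_t_eq: "beta_t t D = real (code_length t D) / real t"
  unfolding beta_t_def code_length_def ..

lemma code_length_le: "index_code D t p F G \<Longrightarrow> code_length t D \<le> p"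
  unfolding code_length_def by (rule Least_le) blast

text \<open>Uncoded transmission works. Hence the \<open>LEAST\<close> in \<open>code_length\<close>
  is attained.\<close>

lemma index_code_exists:
  assumes "finite (verts D)"
  shows "\<exists>p F G. index_code D t p F G"
proof -
  obtain vs where vs: "set vs = verts D" using assms finite_list by blast
  let ?F = "\<lambda>x :: 'a \<Rightarrow> bool list. concat (map x vs)"
  let ?M = "messages (verts D) t"
  have len: "length (x v) = t" if "x \<in> ?M" "v \<in> set vs" for x v
    using that vs by (auto simp: messages_def words_def)
  have "length (?F x) = length vs * t" if "x \<in> ?M" for x
  proof -
    have "map (length \<circ> x) vs = map (\<lambda>_. t) vs" using len[OF that] by simp
    then show ?thesis unfolding length_concat map_map by (simp only: sum_list_triv of_nat_id)
  qed
  moreover have "x r = y r" if "r \<in> verts D" "x \<in> ?M" "y \<in> ?M" "?F x = ?F y" for x y r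
  proof -
    \<comment> \<open>All blocks have \<open>t\<close> bits, so the concatenation splits in only one
      way.\<close>
    have "map x vs = map y vs"
      using that(4) by (rule concat_injective) (auto simp: zip_map1 zip_map2 len that set_zip)
    then show ?thesis using that(1) vs by auto
  qed
  ultimately have "\<exists>G. index_code D t (length vs * t) ?F G"
    unfolding index_code_iff by (auto simp: words_def)
  then show ?thesis by blast
qed

lemma optimal_index_code:
  assumes "finite (verts D)"
  obtains F G where "index_code D t (code_length t D) F G"
  using LeastI_ex[OF index_code_exists[OF assms, of t]] unfolding code_length_def by blast

text \<open>Each message is cut into its first \<open>s\<close> and last \<open>t\<close> bits, the
  two halves are encoded separately, and the codewords are concatenated.\<close>

lemma code_length_add:
  assumes "fin_digraph D"
  shows "code_length (s + t) D \<le> code_length s D + code_length t D"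
proof -
  interpret fin_digraph D by fact
  obtain Fs Gs where s: "index_code D s (code_length s D) Fs Gs"
    using optimal_index_code[OF finite_verts] .
  obtain Ft Gt where t: "index_code D t (code_length t D) Ft Gt"
    using optimal_index_code[OF finite_verts] .
  let ?a = "\<lambda>x. restrict (\<lambda>v. take s (x v)) (verts D)"
  let ?b = "\<lambda>x. restrict (\<lambda>v. drop s (x v)) (verts D)"
  let ?F = "\<lambda>x. Fs (?a x) @ Ft (?b x)"
  have a: "?a x \<in> messages (verts D) s" and b: "?b x \<in> messages (verts D) t"
    if "x \<in> messages (verts D) (s + t)" for x
  proof -
    have "length (x v) = s + t" if "v \<in> verts D" for v
      using \<open>x \<in> _\<close> that by (auto simp: messages_def words_def)
    then show "?a x \<in> messages (verts D) s" "?b x \<in> messages (verts D) t"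
      by (auto simp: messages_def words_def)
  qed
  have lens: "length (Fs (?a x)) = code_length s D" "length (Ft (?b x)) = code_length t D"
    if "x \<in> messages (verts D) (s + t)" for x
    using index_codeD(1)[OF s, OF a] index_codeD(1)[OF t, OF b] that by auto
  have "x r = y r" if xy: "x \<in> messages (verts D) (s + t)" "y \<in> messages (verts D) (s + t)"
    and r: "r \<in> verts D" and eq: "?F x = ?F y" and side: "\<forall>j \<in> out_neighborhood D r. x j = y j"
  for x y r
  proof -
    \<comment> \<open>Codewords have fixed length, so equal concatenations have equal
      halves.\<close>
    have eqs: "Fs (?a x) = Fs (?a y)" "Ft (?b x) = Ft (?b y)" using eq lens xy by auto
    have "?a x r = ?a y r"
      by (rule index_codeD(2)[OF s r, where x = "?a x" and y = "?a y", OF a[OF xy(1)] a[OF xy(2)] eqs(1)]) (simp add: restrict_def side)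
    moreover have "?b x r = ?b y r"
      by (rule index_codeD(2)[OF t r, where x = "?b x" and y = "?b y", OF b[OF xy(1)] b[OF xy(2)] eqs(2)]) (simp add: restrict_def side)
    ultimately show ?thesis using r by (metis append_take_drop_id restrict_apply')
  qed
  then have "\<exists>G. index_code D (s + t) (code_length s D + code_length t D) ?F G"
    unfolding index_code_iff using lens by (auto simp: words_def)
  then show ?thesis using code_length_le by blast
qed

text \<open>Iterated subadditivity. Monotonicity along multiples takes the place of convergence of
  \<open>beta_t\<close> as \<open>t\<close> grows.\<close>

lemma beta_t_mult:
  assumes "fin_digraph D" "k \<ge> 1" "t \<ge> 1"
  shows "beta_t (k * t) D \<le> beta_t t D"
proof -
  have "code_length (k * t) D \<le> k * code_length t D"
    using assms(2)
  proof (induction k rule: dec_induct)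
    case (step n)
    then show ?case using code_length_add[OF assms(1), of t "n * t"] by simp
  qed simp
  then have "real (code_length (k * t) D) \<le> real k * real (code_length t D)"
    by (metis of_nat_le_iff of_nat_mult)
  then show ?thesis using assms by (simp add: beta_t_eq field_simps)
qed

lemma beta_le: "t \<ge> 1 \<Longrightarrow> beta D \<le> beta_t t D"
  unfolding beta_def by (rule cINF_lower) (auto intro!: bdd_belowI[of _ 0] simp: beta_t_def)

lemma two_sender_beta_le: "t \<ge> 1 \<Longrightarrow> two_sender_beta D M1 M2 \<le> two_sender_beta_t t D M1 M2"
  unfolding two_sender_beta_def
  by (rule cINF_lower) (auto intro!: bdd_belowI[of _ 0] simp: two_sender_beta_t_def)

lemma beta_t_approx:
  assumes "e > 0"
  obtains t where "t \<ge> 1" "beta_t t D < beta D + e"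
proof -
  have "\<exists>t \<in> {1..}. beta_t t D < beta D + e"
    using assms unfolding beta_def
    by (subst cINF_less_iff[symmetric])
      (auto intro!: bdd_belowI[of _ 0] simp: beta_t_def)
  then show ?thesis using that by auto
qed

text \<open>The upper bound for two senders uses one message length for all three parts, whereas
  their infima may be approached along different lengths; the product of three good lengths is good
  for each.\<close>

lemma beta_t_approx_common:
  assumes "fin_digraph A" "fin_digraph B" "fin_digraph C" "e > 0"
  obtains t where "t \<ge> 1" "beta_t t A < beta A + e" "beta_t t B < beta B + e"
    "beta_t t C < beta C + e"
proof -
  obtain a where a: "a \<ge> 1" "beta_t a A < beta A + e" using beta_t_approx[OF assms(4)] .
  obtain b where b: "b \<ge> 1" "beta_t b B < beta B + e" using beta_t_approx[OF assms(4)] .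
  obtain c where c: "c \<ge> 1" "beta_t c C < beta C + e" using beta_t_approx[OF assms(4)] .
  show ?thesis
  proof
    show "a * b * c \<ge> 1" using a b c by simp
    show "beta_t (a * b * c) A < beta A + e"
      using beta_t_mult[OF assms(1), of "b * c" a] a b c by (simp add: ac_simps)
    show "beta_t (a * b * c) B < beta B + e"
      using beta_t_mult[OF assms(2), of "a * c" b] a b c by (simp add: ac_simps)
    show "beta_t (a * b * c) C < beta C + e"
      using beta_t_mult[OF assms(3), of "a * b" c] a b c by (simp add: ac_simps)
  qed
qed

section \<open>Bitwise sums of words of different lengths\<close>

definition xor_words :: "bool list \<Rightarrow> bool list \<Rightarrow> bool list" where
  "xor_words a b = map (\<lambda>i. (i < length a \<and> a ! i) \<noteq> (i < length b \<and> b ! i))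
     [0..<max (length a) (length b)]"

lemma length_xor_words [simp]: "length (xor_words a b) = max (length a) (length b)"
  by (simp add: xor_words_def)

lemma xor_words_commute: "xor_words a b = xor_words b a"
  unfolding xor_words_def by (auto simp: max.commute)

text \<open>Equal lengths are essential: padding makes a word and its extension by
  \<open>False\<close> indistinguishable under a longer summand. Codewords of one code satisfy
  this.\<close>

lemma xor_words_left_cancel:
  assumes "length b = length c" and "xor_words a b = xor_words a c"
  shows "b = c"
proof (rule nth_equalityI)
  fix i assume i: "i < length b"
  have "xor_words a b ! i = xor_words a c ! i" using assms(2) by simp
  then show "b ! i = c ! i" using i assms(1) by (auto simp: xor_words_def)
qed fact

lemma xor_words_right_cancel:
  "length a = length b \<Longrightarrow> xor_words a c = xor_words b c \<Longrightarrow> a = b"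
  using xor_words_left_cancel xor_words_commute by metis

section \<open>Two-sender codes: construction and converse\<close>

lemma out_neighborhood_induce:
  "r \<in> S \<Longrightarrow> out_neighborhood (D \<restriction> S) r = out_neighborhood D r \<inter> S"
  by (auto simp: out_neighborhood_def arcs_ends_conv induce_subgraph_def)

text \<open>Applies a code for a part to realizations of the whole problem. A receiver in
  \<open>S\<close> has in \<open>D\<close> at least the side information that it has in the induced
  sub-digraph.\<close>

lemma index_code_induceD:
  assumes "index_code (D \<restriction> S) t p F G" and S: "S \<subseteq> verts D"
    and x: "x \<in> messages (verts D) t" and y: "y \<in> messages (verts D) t"
  shows "length (F (restrict x S)) = p"
    and "r \<in> S \<Longrightarrow> F (restrict x S) = F (restrict y S) \<Longrightarrow>
      \<forall>j \<in> out_neighborhood D r. x j = y j \<Longrightarrow> x r = y r"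
proof -
  have m: "restrict x S \<in> messages (verts (D \<restriction> S)) t" "restrict y S \<in> messages (verts (D \<restriction> S)) t"
    using x y S by (auto simp: messages_def)
  show "length (F (restrict x S)) = p" using index_codeD(1)[OF assms(1), OF m(1)] .
  assume r: "r \<in> S" and "F (restrict x S) = F (restrict y S)"
    and "\<forall>j \<in> out_neighborhood D r. x j = y j"
  then have "restrict x S r = restrict y S r"
    using m
    by - (rule index_codeD(2)[OF assms(1), where x = "restrict x S" and y = "restrict y S"], simp_all add: out_neighborhood_induce)
  then show "x r = y r" using r by simp
qed

text \<open>What an arc of the interaction digraph provides under full participation.\<close>

definition joined :: "('a, 'b) pre_digraph \<Rightarrow> 'a set \<Rightarrow> 'a set \<Rightarrow> bool" where
  "joined D A B \<longleftrightarrow> (\<forall>u \<in> A. \<forall>v \<in> B. u \<rightarrow>\<^bsub>D\<^esub> v)"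

text \<open>\<open>A\<close>, \<open>B\<close>, \<open>C\<close> stand for parts 1, 2, 3. The
  assumptions on \<open>joined\<close> let every receiver isolate the codeword of \<open>C\<close>:
  \<open>A\<close> cancels \<open>FB\<close> in the second sum, \<open>C\<close> cancels
  \<open>FA\<close> in the first, and \<open>B\<close> either cancels \<open>FA\<close> or computes
  \<open>FC\<close> itself.\<close>

lemma two_sender_code_xor:
  assumes M: "M1 \<union> M2 = verts D"
    and A: "index_code (D \<restriction> (M1 - M2)) t pA FA GA"
    and B: "index_code (D \<restriction> (M2 - M1)) t pB FB GB"
    and C: "index_code (D \<restriction> (M1 \<inter> M2)) t pC FC GC"
    and AB: "joined D (M1 - M2) (M2 - M1)"
    and CA: "joined D (M1 \<inter> M2) (M1 - M2)"
    and BAC: "joined D (M2 - M1) (M1 - M2) \<or> joined D (M2 - M1) (M1 \<inter> M2)"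
  shows "\<exists>F1 F2 G. two_sender_index_code D M1 M2 t (max pA pC) (max pB pC) F1 F2 G"
proof -
  let ?A = "M1 - M2" and ?B = "M2 - M1" and ?C = "M1 \<inter> M2"
  let ?M = "messages (verts D) t"
  let ?F1 = "\<lambda>x. xor_words (FA (restrict x ?A)) (FC (restrict x ?C))"
  let ?F2 = "\<lambda>x. xor_words (FB (restrict x ?B)) (FC (restrict x ?C))"
  have sub: "?A \<subseteq> verts D" "?B \<subseteq> verts D" "?C \<subseteq> verts D" using M by auto
  \<comment> \<open>Each sender can form its sum: \<open>A\<close> and \<open>C\<close> lie in
    \<open>M1\<close>, \<open>B\<close> and \<open>C\<close> in \<open>M2\<close>.\<close>
  have restr: "restrict (restrict x M1) ?A = restrict x ?A" "restrict (restrict x M1) ?C = restrict x ?C"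
    "restrict (restrict x M2) ?B = restrict x ?B" "restrict (restrict x M2) ?C = restrict x ?C"
    for x :: "'a \<Rightarrow> bool list"
    by (auto simp: restrict_eq_iff)
  have F: "FA x \<in> words pA" if "x \<in> messages ?A t" for x
    using index_codeD(1)[OF A, of x] that by (simp add: words_def)
  have F': "FB x \<in> words pB" if "x \<in> messages ?B t" for x
    using index_codeD(1)[OF B, of x] that by (simp add: words_def)
  have F'': "FC x \<in> words pC" if "x \<in> messages ?C t" for x
    using index_codeD(1)[OF C, of x] that by (simp add: words_def)
  have xor: "xor_words a c \<in> words (max p q)" if "a \<in> words p" "c \<in> words q" for a c p q
    using that by (simp add: words_def)
  have F1: "?F1 \<in> messages M1 t \<rightarrow> words (max pA pC)"
    by (intro Pi_I xor F F'') (auto simp: messages_def)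
  have F2: "?F2 \<in> messages M2 t \<rightarrow> words (max pB pC)"
    by (intro Pi_I xor F' F'') (auto simp: messages_def)
  have "x r = y r" if r: "r \<in> verts D" and x: "x \<in> ?M" and y: "y \<in> ?M"
    and e1: "?F1 x = ?F1 y" and e2: "?F2 x = ?F2 y" and side: "\<forall>j \<in> out_neighborhood D r. x j = y j"
  for x y r
  proof -
    have l: "length (FA (restrict x ?A)) = length (FA (restrict y ?A))"
      "length (FB (restrict x ?B)) = length (FB (restrict y ?B))"
      "length (FC (restrict x ?C)) = length (FC (restrict y ?C))"
      using index_code_induceD(1)[OF A sub(1) x y] index_code_induceD(1)[OF A sub(1) y x]
        index_code_induceD(1)[OF B sub(2) x y] index_code_induceD(1)[OF B sub(2) y x]
        index_code_induceD(1)[OF C sub(3) x y] index_code_induceD(1)[OF C sub(3) y x]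
      by simp_all
    have cancel: "FC (restrict x ?C) = FC (restrict y ?C)"
      if "xor_words a (FC (restrict x ?C)) = xor_words a (FC (restrict y ?C))" for a
      using xor_words_left_cancel[OF l(3) that] .
    \<comment> \<open>If the receiver knows all of \<open>T\<close>, the codeword of part
      \<open>T\<close> is the same for \<open>x\<close> and \<open>y\<close>, and is thus a common
      summand.\<close>
    have known: "restrict x T = restrict y T" if "joined D S T" "r \<in> S" for S T
      using that side by (auto simp: joined_def restrict_eq_iff out_neighborhood_def)
    consider "r \<in> ?A" | "r \<in> ?B" | "r \<in> ?C" using r M by blast
    then show ?thesis
    proof cases
      case 1
      have "FC (restrict x ?C) = FC (restrict y ?C)"
        using e2 unfolding known[OF AB 1] by (rule cancel)
      then have "FA (restrict x ?A) = FA (restrict y ?A)"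
        using e1 xor_words_right_cancel[OF l(1), of "FC (restrict y ?C)"] by simp
      then show ?thesis by (rule index_code_induceD(2)[OF A sub(1) x y 1 _ side])
    next
      case 2
      have "FC (restrict x ?C) = FC (restrict y ?C)"
        using BAC
      proof
        assume BA: "joined D ?B ?A"
        show ?thesis using e1 unfolding known[OF BA 2] by (rule cancel)
      next
        assume BC: "joined D ?B ?C"
        show ?thesis unfolding known[OF BC 2] ..
      qed
      then have "FB (restrict x ?B) = FB (restrict y ?B)"
        using e2 xor_words_right_cancel[OF l(2), of "FC (restrict y ?C)"] by simp
      then show ?thesis by (rule index_code_induceD(2)[OF B sub(2) x y 2 _ side])
    next
      case 3
      have "FC (restrict x ?C) = FC (restrict y ?C)"
        using e1 unfolding known[OF CA 3] by (rule cancel)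
      then show ?thesis by (rule index_code_induceD(2)[OF C sub(3) x y 3 _ side])
    qed
  qed
  then have "\<exists>G. two_sender_index_code D M1 M2 t (max pA pC) (max pB pC) ?F1 ?F2 G"
    unfolding two_sender_index_code_iff restr using F1 F2 by blast
  then show ?thesis by blast
qed

text \<open>Fixing all messages outside \<open>M1 - M2\<close> makes the second sub-codeword and the side information
  from the other parts constant.\<close>

lemma two_sender_code_ge:
  assumes wf: "wf_digraph D" and M: "M1 \<union> M2 = verts D"
    and code: "two_sender_index_code D M1 M2 t p1 p2 F1 F2 G"
  shows "code_length t (D \<restriction> (M1 - M2)) \<le> p1"
proof -
  let ?A = "M1 - M2"
  \<comment> \<open>The fixed messages are all zero; any fixed words of length \<open>t\<close>
    would serve.\<close>
  let ?x = "\<lambda>y. restrict (\<lambda>v. if v \<in> ?A then y v else replicate t False) (verts D)"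
  let ?F = "\<lambda>y. F1 (restrict (?x y) M1)"
  have F1: "F1 z \<in> words p1" if "z \<in> messages M1 t" for z
    using code that by (auto simp: two_sender_index_code_def)
  have dec: "G r (F1 (restrict z M1)) (F2 (restrict z M2)) (restrict z (out_neighborhood D r)) = z r"
    if "z \<in> messages (verts D) t" "r \<in> verts D" for z r
    using code that by (simp add: two_sender_index_code_def)
  have x: "?x y \<in> messages (verts D) t" "restrict (?x y) M1 \<in> messages M1 t"
    if "y \<in> messages ?A t" for y
    using that M by (auto simp: messages_def words_def)
  have F2: "restrict (?x y) M2 = restrict (?x z) M2" for y z
    by (auto simp: restrict_eq_iff restrict_def)
  have "y r = z r" if r: "r \<in> ?A" and yz: "y \<in> messages ?A t" "z \<in> messages ?A t"
    and eq: "?F y = ?F z" and side: "\<forall>j \<in> out_neighborhood (D \<restriction> ?A) r. y j = z j" for y z r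
  proof -
    have O: "restrict (?x y) (out_neighborhood D r) = restrict (?x z) (out_neighborhood D r)"
      unfolding restrict_eq_iff using side r by (auto simp: out_neighborhood_induce restrict_def)
    have "r \<in> verts D" using r M by blast
    from dec[OF x(1)[OF yz(1)] this] dec[OF x(1)[OF yz(2)] this]
    have "?x y r = ?x z r" unfolding eq F2[of y z] O by (rule trans[OF sym])
    then show ?thesis using r M by (auto simp: restrict_def split: if_splits)
  qed
  then have "\<exists>G. index_code (D \<restriction> ?A) t p1 ?F G"
    unfolding index_code_iff using F1[OF x(2)] by simp
  then show ?thesis using code_length_le by blast
qed

section \<open>Full participation and the listed interactions\<close>

text \<open>Full participation for one ordered pair of parts, free of labels, which exposes the
  symmetry between the senders.\<close>

definition uniform :: "('a, 'b) pre_digraph \<Rightarrow> 'a set \<Rightarrow> 'a set \<Rightarrow> bool" where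
  "uniform D A B \<longleftrightarrow> (\<exists>u \<in> A. \<exists>v \<in> B. u \<rightarrow>\<^bsub>D\<^esub> v) \<longrightarrow> joined D A B"

lemma parcs_interaction_digraph_iff:
  "(i, j) \<in> parcs (interaction_digraph D M1 M2) \<longleftrightarrow> i \<in> {1, 2, 3} \<and> j \<in> {1, 2, 3} \<and> i \<noteq> j \<and>
     (\<exists>u \<in> message_part M1 M2 i. \<exists>v \<in> message_part M1 M2 j. u \<rightarrow>\<^bsub>D\<^esub> v)"
  by (simp add: interaction_digraph_def sub_digraph_def)

lemma fully_participated_iff_arcs:
  "fully_participated D M1 M2 \<longleftrightarrow> (\<forall>i j. (i, j) \<in> parcs (interaction_digraph D M1 M2) \<longrightarrow>
     joined D (message_part M1 M2 i) (message_part M1 M2 j))"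
  unfolding fully_participated_def joined_def sub_digraph_def induce_subgraph_verts by blast

lemma fully_participated_iff:
  "fully_participated D M1 M2 \<longleftrightarrow> (\<forall>i \<in> {1, 2, 3}. \<forall>j \<in> {1, 2, 3}. i \<noteq> j \<longrightarrow>
     uniform D (message_part M1 M2 i) (message_part M1 M2 j))"
  unfolding fully_participated_iff_arcs parcs_interaction_digraph_iff uniform_def by blast

text \<open>Exchanging the senders permutes parts 1 and 2, and the condition ranges over all ordered
  pairs of distinct parts.\<close>

lemma fully_participated_swap: "fully_participated D M1 M2 \<longleftrightarrow> fully_participated D M2 M1"
  unfolding fully_participated_iff by (simp add: message_part_def Int_commute conj_ac)

lemma message_part_simps:
  "message_part M1 M2 1 = M1 - M2" "message_part M1 M2 2 = M2 - M1"
  "message_part M1 M2 3 = M1 \<inter> M2"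
  by (simp_all add: message_part_def)

text \<open>The common core of the four arc sets: each contains \<open>(1, 2)\<close> and
  \<open>(3, 1)\<close>, and at least one of \<open>(2, 1)\<close> and
  \<open>(2, 3)\<close>.\<close>

lemma listed_interactions_joined:
  assumes fp: "fully_participated D M1 M2"
    and listed: "parcs (interaction_digraph D M1 M2) \<in> listed_interactions"
  shows "joined D (M1 - M2) (M2 - M1)" "joined D (M1 \<inter> M2) (M1 - M2)"
    "joined D (M2 - M1) (M1 - M2) \<or> joined D (M2 - M1) (M1 \<inter> M2)"
proof -
  have E: "(1, 2) \<in> E \<and> (3, 1) \<in> E \<and> ((2, 1) \<in> E \<or> (2, 3) \<in> E)" if "E \<in> listed_interactions" for E
    using that unfolding listed_interactions_def by (elim insertE emptyE) simp_all
  have J: "joined D (message_part M1 M2 i) (message_part M1 M2 j)"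
    if "(i, j) \<in> parcs (interaction_digraph D M1 M2)" for i j
    using fp that unfolding fully_participated_iff_arcs by blast
  show "joined D (M1 - M2) (M2 - M1)" "joined D (M1 \<inter> M2) (M1 - M2)"
    "joined D (M2 - M1) (M1 - M2) \<or> joined D (M2 - M1) (M1 \<inter> M2)"
    using E[OF listed] J[of 1 2] J[of 3 1] J[of 2 1] J[of 2 3]
    unfolding message_part_simps by blast+
qed

lemma (in fin_digraph) fin_digraph_induce:
  assumes "S \<subseteq> verts G"
  shows "fin_digraph (G \<restriction> S)"
proof -
  interpret S: wf_digraph "G \<restriction> S" by (rule wellformed_induce_subgraph)
  show ?thesis
    using finite_subset[OF assms finite_verts] finite_arcs by unfold_locales simp_all
qed

lemma two_sender_code_listed:
  assumes dg: "fin_digraph D" and M: "M1 \<union> M2 = verts D"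
    and fp: "fully_participated D M1 M2"
    and listed: "parcs (interaction_digraph D M1 M2) \<in> listed_interactions"
  shows "\<exists>F1 F2 G. two_sender_index_code D M1 M2 t
    (max (code_length t (D \<restriction> (M1 - M2))) (code_length t (D \<restriction> (M1 \<inter> M2))))
    (max (code_length t (D \<restriction> (M2 - M1))) (code_length t (D \<restriction> (M1 \<inter> M2)))) F1 F2 G"
proof -
  have fin: "finite (verts (D \<restriction> S))" if "S \<subseteq> verts D" for S
    using finite_subset[OF that fin_digraph.finite_verts[OF dg]] by simp
  have sub: "M1 - M2 \<subseteq> verts D" "M2 - M1 \<subseteq> verts D" "M1 \<inter> M2 \<subseteq> verts D" using M by auto
  obtain FA GA where A: "index_code (D \<restriction> (M1 - M2)) t (code_length t (D \<restriction> (M1 - M2))) FA GA"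
    by (rule optimal_index_code[OF fin[OF sub(1)]])
  obtain FB GB where B: "index_code (D \<restriction> (M2 - M1)) t (code_length t (D \<restriction> (M2 - M1))) FB GB"
    by (rule optimal_index_code[OF fin[OF sub(2)]])
  obtain FC GC where C: "index_code (D \<restriction> (M1 \<inter> M2)) t (code_length t (D \<restriction> (M1 \<inter> M2))) FC GC"
    by (rule optimal_index_code[OF fin[OF sub(3)]])
  show ?thesis
    by (rule two_sender_code_xor[OF M A B C listed_interactions_joined[OF fp listed]])
qed

section \<open>Bounds for fixed message length and in the limit\<close>

theorem theorem8:
  fixes N :: nat
    and D :: "(nat, 'b) pre_digraph"
    and M1 M2 :: "nat set"
  defines "D1 \<equiv> sub_digraph D M1 M2 1"
    and "D2 \<equiv> sub_digraph D M1 M2 2"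
    and "D3 \<equiv> sub_digraph D M1 M2 3"
  assumes "digraph D"
    and "verts D = {1..N}"
    and "M1 \<union> M2 = {1..N}"
    and "fully_participated D M1 M2"
    and "parcs (interaction_digraph D M1 M2) \<in> listed_interactions \<or>
         parcs (interaction_digraph D M2 M1) \<in> listed_interactions"
  shows "(\<forall>t\<ge>1. two_sender_beta_t t D M1 M2
            \<le> max (beta_t t D1) (beta_t t D3) + max (beta_t t D2) (beta_t t D3)) \<and>
         (\<forall>t\<ge>1. beta_t t D3 \<le> min (beta_t t D1) (beta_t t D2) \<longrightarrow>
            two_sender_beta_t t D M1 M2 = beta_t t D1 + beta_t t D2) \<and>
         two_sender_beta D M1 M2 \<le> max (beta D1) (beta D3) + max (beta D2) (beta D3) \<and>
         (beta D3 \<le> min (beta D1) (beta D2) \<longrightarrow>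
            two_sender_beta D M1 M2 = beta D1 + beta D2)"
proof -
  interpret digraph D by fact
  have D: "D1 = D \<restriction> (M1 - M2)" "D2 = D \<restriction> (M2 - M1)" "D3 = D \<restriction> (M1 \<inter> M2)"
    unfolding D1_def D2_def D3_def sub_digraph_def by (simp_all only: message_part_simps)
  have M: "M1 \<union> M2 = verts D" "M2 \<union> M1 = verts D" using assms by auto
  have fin: "fin_digraph D1" "fin_digraph D2" "fin_digraph D3"
    unfolding D using M by (intro fin_digraph_induce, blast)+
  let ?P = "\<lambda>t p. \<exists>p1 p2 F1 F2 G. p = p1 + p2 \<and> two_sender_index_code D M1 M2 t p1 p2 F1 F2 G"
  define L where "L t = (LEAST p. ?P t p)" for t
  have L: "two_sender_beta_t t D M1 M2 = real (L t) / real t" for t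
    unfolding two_sender_beta_t_def L_def ..
  let ?l = "code_length"
  \<comment> \<open>Used twice: it bounds the minimum \<open>L t\<close> from above, and it shows
    that the minimum is attained, as the lower bound requires.\<close>
  have ach: "?P t (max (?l t D1) (?l t D3) + max (?l t D2) (?l t D3))" for t
    using assms(8)
  proof
    assume "parcs (interaction_digraph D M1 M2) \<in> listed_interactions"
    from two_sender_code_listed[OF fin_digraph_axioms M(1) assms(7) this]
    show ?thesis unfolding D by blast
  next
    assume "parcs (interaction_digraph D M2 M1) \<in> listed_interactions"
    \<comment> \<open>The code is built for the exchanged senders and then swapped back; part 3 is
      unaffected.\<close>
    from two_sender_code_listed[OF fin_digraph_axioms M(2) fully_participated_swap[THEN iffD1, OF assms(7)] this]
    show ?thesis
      unfolding D using two_sender_index_code_swap[of D M1 M2] by (metis Int_commute)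
  qed
  have "L t \<le> max (?l t D1) (?l t D3) + max (?l t D2) (?l t D3)" for t
    unfolding L_def by (rule Least_le) (rule ach)
  then have *: "real (L t) \<le> max (real (?l t D1)) (real (?l t D3)) + max (real (?l t D2)) (real (?l t D3))" for t
    by (metis of_nat_add of_nat_le_iff of_nat_max)
  then have upper: "two_sender_beta_t t D M1 M2
      \<le> max (beta_t t D1) (beta_t t D3) + max (beta_t t D2) (beta_t t D3)" if "t \<ge> 1" for t
    using divide_right_mono[OF *, of "real t" t] unfolding L beta_t_eq
    by (simp add: add_divide_distrib max_divide_distrib_right)
  have "?l t D1 + ?l t D2 \<le> L t" for t
  proof -
    have "?P t (L t)" unfolding L_def by (rule LeastI) (rule ach)
    then obtain p1 p2 F1 F2 G where p: "L t = p1 + p2"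
      and code: "two_sender_index_code D M1 M2 t p1 p2 F1 F2 G" by blast
    \<comment> \<open>The converse bounds only the first sub-codeword; the swapped code yields the
      bound on \<open>p2\<close>.\<close>
    obtain F1' F2' G' where code': "two_sender_index_code D M2 M1 t p2 p1 F1' F2' G'"
      using code two_sender_index_code_swap[of D M1 M2] by blast
    show ?thesis
      unfolding p D
      using two_sender_code_ge[OF wf_digraph_axioms M(1) code]
        two_sender_code_ge[OF wf_digraph_axioms M(2) code'] by simp
  qed
  then have "real (?l t D1) + real (?l t D2) \<le> real (L t)" for t
    by (metis of_nat_add of_nat_le_iff)
  then have lower: "beta_t t D1 + beta_t t D2 \<le> two_sender_beta_t t D M1 M2" for t
    unfolding L beta_t_eq by (simp add: add_divide_distrib[symmetric] divide_right_mono)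
  have upper_lim: "two_sender_beta D M1 M2 \<le> max (beta D1) (beta D3) + max (beta D2) (beta D3)"
  proof (rule field_le_epsilon)
    fix e :: real assume "e > 0"
    \<comment> \<open>Each of the two maxima exceeds its limit value by at most
      \<open>e / 2\<close>.\<close>
    then obtain t where "t \<ge> 1" "beta_t t D1 < beta D1 + e / 2" "beta_t t D2 < beta D2 + e / 2"
      "beta_t t D3 < beta D3 + e / 2"
      using beta_t_approx_common[OF fin, of "e / 2"] by auto
    then show "two_sender_beta D M1 M2 \<le> max (beta D1) (beta D3) + max (beta D2) (beta D3) + e"
      using upper[of t] two_sender_beta_le[of t D M1 M2] by (auto simp: max_def split: if_splits)
  qed
  \<comment> \<open>No common message length is needed here: for every \<open>t\<close>, both
    \<open>beta D1\<close> and \<open>beta D2\<close> lie below their rates at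
    \<open>t\<close>.\<close>
  have lower_lim: "beta D1 + beta D2 \<le> two_sender_beta D M1 M2"
    unfolding two_sender_beta_def
  proof (rule cINF_greatest)
    fix t :: nat assume "t \<in> {1..}"
    then show "beta D1 + beta D2 \<le> two_sender_beta_t t D M1 M2"
      using beta_le[of t D1] beta_le[of t D2] lower[of t] by simp
  qed simp
  \<comment> \<open>Under the hypotheses of the two equalities the maxima collapse to the rates of
    \<open>D1\<close> and \<open>D2\<close>, so upper and lower bounds meet.\<close>
  show ?thesis
  proof (intro conjI allI impI)
    fix t :: nat assume t: "t \<ge> 1"
    show "two_sender_beta_t t D M1 M2
        \<le> max (beta_t t D1) (beta_t t D3) + max (beta_t t D2) (beta_t t D3)"
      by (rule upper[OF t])
    assume "beta_t t D3 \<le> min (beta_t t D1) (beta_t t D2)"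
    then show "two_sender_beta_t t D M1 M2 = beta_t t D1 + beta_t t D2"
      using upper[OF t] lower[of t] by (simp add: max_def split: if_splits)
  next
    assume "beta D3 \<le> min (beta D1) (beta D2)"
    then show "two_sender_beta D M1 M2 = beta D1 + beta D2"
      using upper_lim lower_lim by (simp add: max_def split: if_splits)
  qed (rule upper_lim)
qed

end
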